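(* Let $G$ be a connected uniform graph and let $m\ge 1$ be an integer. If every minimal vertex separator in $G$ has diameter at most $m$, then $G$ is $(m+\epsilon)$-densely $(4m,2m-1)$-chordal for every $\epsilon>\frac12$.
   Context: Every edge of the connected graph $G$ has length $1$, interior points of edges are points of $G$, and $d$ is the induced shortest-path (length) metric on $G$; $V(G)$ is the vertex set. Diameters are taken with respect to $d$. $G$ is uniform if there is a constant $\mu$ such that every vertex has at most $\mu$ neighbors. A set $S\subset V(G)$ is an $ab$-separator (for vertices $a,b$) if $a$ and $b$ lie in different connected components of $G\setminus S$. It is a minimal $ab$-separator if no proper subset of $S$ separates $a$ and $b$. $S$ is a minimal vertex separator if it is a minimal $ab$-separator for some pair of vertices $a,b$. Paths are finite and simple (distinct vertices). A cycle is a simple closed curve, given by a sequence of vertices all different except that the first and last coincide. $L(\cdot)$ denotes length. For a cycle $C$, $d_C$ denotes the length metric on $C$. A shortcut in $C$ is a path $\sigma$ in $G$ joining two vertices $p,q$ of $C$ with $L(\sigma)<d_C(p,q)$; it is strict if $\sigma\cap C=\{p,q\}$, and then $p,q$ are the shortcut vertices associated to $\sigma$. A subset $A$ of a metric space $(X,\rho)$ is $\varepsilon$-dense if for every $x\in X$ there is $a\in A$ with $\rho(a,x)<\varepsilon$. $G$ is $\varepsilon$-densely $(k,m)$-chordal if for every cycle $C$ with $L(C)\ge k$ there exist strict shortcuts $\sigma_1,\dots,\sigma_r$ in $C$ with $L(\sigma_i)\le m$ for all $i$ whose associated shortcut vertices form an $\varepsilon$-dense subset of $(C,d_C)$. It is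 always assumed that $k\ge4$ and $k\ge 2m$. *)

theory Defs
  imports "HOL-Analysis.Analysis"
begin

definition simple_graph :: "'v set \<Rightarrow> 'v set set \<Rightarrow> bool" where
  "simple_graph V E \<longleftrightarrow> (\<forall>e\<in>E. e \<subseteq> V \<and> card e = 2)"

definition uniform_graph :: "'v set \<Rightarrow> 'v set set \<Rightarrow> bool" where
  "uniform_graph V E \<longleftrightarrow>
     (\<exists>\<mu>::nat. \<forall>v\<in>V. finite {w. {v, w} \<in> E} \<and> card {w. {v, w} \<in> E} \<le> \<mu>)"

definition walk_edges :: "'v list \<Rightarrow> 'v set set" where
  "walk_edges vs = {{vs ! i, vs ! Suc i} | i. Suc i < length vs}"

definition walk_length :: "'v list \<Rightarrow> nat" where
  "walk_length vs = length vs - 1"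

definition is_path :: "'v set \<Rightarrow> 'v set set \<Rightarrow> 'v list \<Rightarrow> bool" where
  "is_path V E vs \<longleftrightarrow>
     vs \<noteq> [] \<and> set vs \<subseteq> V \<and> distinct vs \<and> walk_edges vs \<subseteq> E"

definition connected_graph :: "'v set \<Rightarrow> 'v set set \<Rightarrow> bool" where
  "connected_graph V E \<longleftrightarrow>
     (\<forall>u\<in>V. \<forall>v\<in>V. \<exists>vs. is_path V E vs \<and> hd vs = u \<and> last vs = v)"

text \<open>A cycle is the closed list of its vertices, the first one being repeated at the end.
  The bound on the length says that there are at least three vertices, so that the
  closed curve traced out is simple.\<close>

definition is_cycle :: "'v set \<Rightarrow> 'v set set \<Rightarrow> 'v list \<Rightarrow> bool" where
  "is_cycle V E vs \<longleftrightarrow>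
     4 \<le> length vs \<and> hd vs = last vs \<and> distinct (tl vs) \<and> set vs \<subseteq> V \<and> walk_edges vs \<subseteq> E"

text \<open>The points of a graph, interior points of edges included, in barycentric coordinates:
  the point of the edge \<open>{u, v}\<close> at distance \<open>t\<close> from \<open>u\<close> is the function with value
  \<open>1 - t\<close> at \<open>u\<close>, \<open>t\<close> at \<open>v\<close> and \<open>0\<close> elsewhere. The points of a subgraph are thus points of
  the graph.\<close>

definition vertex_point :: "'v \<Rightarrow> 'v \<Rightarrow> real" where
  "vertex_point v = (\<lambda>w. if w = v then 1 else 0)"

definition closed_edge :: "'v set \<Rightarrow> ('v \<Rightarrow> real) set" where
  "closed_edge e = {x. (\<forall>v. 0 \<le> x v) \<and> (\<forall>v. v \<notin> e \<longrightarrow> x v = 0) \<and> (\<Sum>v\<in>e. x v) = 1}"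

definition graph_points :: "'v set \<Rightarrow> 'v set set \<Rightarrow> ('v \<Rightarrow> real) set" where
  "graph_points V E = vertex_point ` V \<union> (\<Union>e\<in>E. closed_edge e)"

text \<open>The distance inside one edge, which makes the edge isometric to the unit interval:
  the two coordinates of a point sum to \<open>1\<close>, so both contribute the same difference.\<close>

definition edge_dist :: "'v set \<Rightarrow> ('v \<Rightarrow> real) \<Rightarrow> ('v \<Rightarrow> real) \<Rightarrow> real" where
  "edge_dist e x y = (\<Sum>v\<in>e. \<bar>x v - y v\<bar>) / 2"

text \<open>\<open>joined V E x y l\<close>: some piecewise linear curve of length \<open>l\<close> goes from \<open>x\<close> to \<open>y\<close>.\<close>

inductive joined :: "'v set \<Rightarrow> 'v set set \<Rightarrow> ('v \<Rightarrow> real) \<Rightarrow> ('v \<Rightarrow> real) \<Rightarrow> real \<Rightarrow> bool"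
  for V E where
  refl: "x \<in> graph_points V E \<Longrightarrow> joined V E x x 0"
| step: "joined V E x y l \<Longrightarrow> e \<in> E \<Longrightarrow> y \<in> closed_edge e \<Longrightarrow> z \<in> closed_edge e \<Longrightarrow>
         joined V E x z (l + edge_dist e y z)"

text \<open>The length metric. The value \<open>0\<close> is only a default for points that no curve joins.\<close>

definition graph_dist :: "'v set \<Rightarrow> 'v set set \<Rightarrow> ('v \<Rightarrow> real) \<Rightarrow> ('v \<Rightarrow> real) \<Rightarrow> real" where
  "graph_dist V E x y = (if \<exists>l. joined V E x y l then Inf {l. joined V E x y l} else 0)"

definition graph_topology :: "'v set \<Rightarrow> 'v set set \<Rightarrow> ('v \<Rightarrow> real) topology" where
  "graph_topology V E = Metric_space.mtopology (graph_points V E) (graph_dist V E)"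

text \<open>Extended values, since a set of vertices may be infinite and then have infinite diameter.\<close>

definition vertex_set_diam :: "'v set \<Rightarrow> 'v set set \<Rightarrow> 'v set \<Rightarrow> ennreal" where
  "vertex_set_diam V E S =
     (SUP u\<in>S. SUP v\<in>S. ennreal (graph_dist V E (vertex_point u) (vertex_point v)))"

definition ab_separator :: "'v set \<Rightarrow> 'v set set \<Rightarrow> 'v \<Rightarrow> 'v \<Rightarrow> 'v set \<Rightarrow> bool" where
  "ab_separator V E a b S \<longleftrightarrow>
     S \<subseteq> V \<and> a \<in> V - S \<and> b \<in> V - S \<and>
     \<not> connected_component_of
         (subtopology (graph_topology V E) (graph_points V E - vertex_point ` S))
         (vertex_point a) (vertex_point b)"

definition minimal_ab_separator :: "'v set \<Rightarrow> 'v set set \<Rightarrow> 'v \<Rightarrow> 'v \<Rightarrow> 'v set \<Rightarrow> bool" where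
  "minimal_ab_separator V E a b S \<longleftrightarrow>
     ab_separator V E a b S \<and> (\<forall>T. T \<subset> S \<longrightarrow> \<not> ab_separator V E a b T)"

definition minimal_vertex_separator :: "'v set \<Rightarrow> 'v set set \<Rightarrow> 'v set \<Rightarrow> bool" where
  "minimal_vertex_separator V E S \<longleftrightarrow> (\<exists>a\<in>V. \<exists>b\<in>V. minimal_ab_separator V E a b S)"

text \<open>The subset of the graph traced out by a path or a cycle.\<close>

definition walk_points :: "'v list \<Rightarrow> ('v \<Rightarrow> real) set" where
  "walk_points vs = graph_points (set vs) (walk_edges vs)"

definition cycle_dist :: "'v list \<Rightarrow> ('v \<Rightarrow> real) \<Rightarrow> ('v \<Rightarrow> real) \<Rightarrow> real" where
  "cycle_dist C = graph_dist (set C) (walk_edges C)"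

definition shortcut :: "'v set \<Rightarrow> 'v set set \<Rightarrow> 'v list \<Rightarrow> 'v list \<Rightarrow> bool" where
  "shortcut V E C \<sigma> \<longleftrightarrow>
     is_path V E \<sigma> \<and> hd \<sigma> \<in> set C \<and> last \<sigma> \<in> set C \<and>
     real (walk_length \<sigma>) < cycle_dist C (vertex_point (hd \<sigma>)) (vertex_point (last \<sigma>))"

definition strict_shortcut :: "'v set \<Rightarrow> 'v set set \<Rightarrow> 'v list \<Rightarrow> 'v list \<Rightarrow> bool" where
  "strict_shortcut V E C \<sigma> \<longleftrightarrow>
     shortcut V E C \<sigma> \<and>
     walk_points \<sigma> \<inter> walk_points C = {vertex_point (hd \<sigma>), vertex_point (last \<sigma>)}"

definition eps_dense :: "'p set \<Rightarrow> ('p \<Rightarrow> 'p \<Rightarrow> real) \<Rightarrow> real \<Rightarrow> 'p set \<Rightarrow> bool" where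
  "eps_dense X \<rho> \<epsilon> A \<longleftrightarrow> A \<subseteq> X \<and> (\<forall>x\<in>X. \<exists>a\<in>A. \<rho> a x < \<epsilon>)"

definition densely_chordal ::
    "'v set \<Rightarrow> 'v set set \<Rightarrow> real \<Rightarrow> real \<Rightarrow> real \<Rightarrow> bool" where
  "densely_chordal V E \<epsilon> k m \<longleftrightarrow>
     4 \<le> k \<and> 2 * m \<le> k \<and>
     (\<forall>C. is_cycle V E C \<and> k \<le> real (walk_length C) \<longrightarrow>
        (\<exists>\<sigma>s. (\<forall>\<sigma>\<in>set \<sigma>s. strict_shortcut V E C \<sigma> \<and> real (walk_length \<sigma>) \<le> m) \<and>
              eps_dense (walk_points C) (cycle_dist C) \<epsilon>
                (\<Union>\<sigma>\<in>set \<sigma>s. {vertex_point (hd \<sigma>), vertex_point (last \<sigma>)})))"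

text \<open>The length metric of a connected graph is a metric on its set of points, so that
  \<open>graph_topology\<close> is the metric topology.\<close>

lemma joined_points:
  "joined V E x y l \<Longrightarrow> x \<in> graph_points V E \<and> y \<in> graph_points V E"
  by (induction rule: joined.induct) (auto simp: graph_points_def)

lemma edge_dist_nonneg: "0 \<le> edge_dist e x y"
  unfolding edge_dist_def by (simp add: sum_nonneg)

lemma edge_dist_commute: "edge_dist e x y = edge_dist e y x"
  unfolding edge_dist_def by (simp add: abs_minus_commute)

lemma joined_nonneg: "joined V E x y l \<Longrightarrow> 0 \<le> l"
  by (induction rule: joined.induct) (auto intro: add_nonneg_nonneg edge_dist_nonneg)

lemma joined_trans:
  "joined V E y z l' \<Longrightarrow> joined V E x y l \<Longrightarrow> joined V E x z (l + l')"
  by (induction rule: joined.induct) (auto simp: add.assoc[symmetric] intro: joined.step)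

lemma joined_edge:
  assumes "e \<in> E" "x \<in> closed_edge e" "y \<in> closed_edge e"
  shows "joined V E x y (edge_dist e x y)"
proof -
  have "joined V E x x 0"
    using assms by (intro joined.refl) (auto simp: graph_points_def)
  from joined.step[OF this assms] show ?thesis by simp
qed

lemma joined_sym: "joined V E x y l \<Longrightarrow> joined V E y x l"
proof (induction rule: joined.induct)
  case (step x y l e z)
  have "joined V E z y (edge_dist e z y)"
    using step by (intro joined_edge) auto
  from joined_trans[OF step.IH this] show ?case
    by (simp add: edge_dist_commute add.commute)
qed (rule joined.refl)

lemma edge_dist_coordinate:
  assumes "card e = 2" "x \<in> closed_edge e" "y \<in> closed_edge e"
  shows "\<bar>x v - y v\<bar> \<le> edge_dist e x y"
proof -
  obtain a b where e: "e = {a, b}" "a \<noteq> b"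
    using assms(1) by (meson card_2_iff)
  have s: "x a + x b = 1" "y a + y b = 1"
    using assms(2,3) e by (auto simp: closed_edge_def)
  show ?thesis
  proof (cases "v \<in> e")
    case True
    then show ?thesis using e s by (auto simp: edge_dist_def)
  next
    case False
    then show ?thesis
      using assms(2,3) edge_dist_nonneg[of e x y] by (auto simp: closed_edge_def)
  qed
qed

lemma joined_coordinate:
  assumes "simple_graph V E" "joined V E x y l"
  shows "\<bar>x v - y v\<bar> \<le> l"
  using assms(2)
proof (induction rule: joined.induct)
  case (step x y l e z)
  have "\<bar>y v - z v\<bar> \<le> edge_dist e y z"
    using step assms(1) by (intro edge_dist_coordinate) (auto simp: simple_graph_def)
  with step.IH show ?case by linarith
qed simp

lemma vertex_point_closed_edge: "finite e \<Longrightarrow> v \<in> e \<Longrightarrow> vertex_point v \<in> closed_edge e"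
  by (auto simp: vertex_point_def closed_edge_def sum.delta)

lemma joined_vertex: "v \<in> V \<Longrightarrow> joined V E (vertex_point v) (vertex_point v) 0"
  by (rule joined.refl) (simp add: graph_points_def)

lemma joined_path:
  assumes "simple_graph V E" "vs \<noteq> []" "set vs \<subseteq> V" "walk_edges vs \<subseteq> E"
  shows "\<exists>l. joined V E (vertex_point (hd vs)) (vertex_point (last vs)) l"
  using assms(2-)
proof (induction vs)
  case (Cons u vs)
  show ?case
  proof (cases vs)
    case Nil
    have "joined V E (vertex_point u) (vertex_point u) 0"
      using Cons.prems by (intro joined_vertex) simp
    then show ?thesis using Nil by auto
  next
    case (Cons w ws)
    have "walk_edges vs \<subseteq> walk_edges (u # vs)"
    proof
      fix e assume "e \<in> walk_edges vs"
      then obtain i where "e = {vs ! i, vs ! Suc i}" "Suc i < length vs"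
        unfolding walk_edges_def by auto
      then show "e \<in> walk_edges (u # vs)"
        unfolding walk_edges_def by (intro CollectI exI[of _ "Suc i"]) simp
    qed
    then obtain l where l: "joined V E (vertex_point w) (vertex_point (last vs)) l"
      using Cons.IH Cons.prems Cons by auto
    have "{u, w} \<in> walk_edges (u # vs)"
      unfolding walk_edges_def using Cons by (auto intro!: exI[of _ 0])
    then have "joined V E (vertex_point u) (vertex_point w)
                 (edge_dist {u, w} (vertex_point u) (vertex_point w))"
      using Cons.prems by (intro joined_edge vertex_point_closed_edge) auto
    from joined_trans[OF l this] show ?thesis
      using Cons by auto
  qed
qed simp

lemma joined_exists:
  assumes "simple_graph V E" "connected_graph V E"
    and "x \<in> graph_points V E" "y \<in> graph_points V E"
  shows "\<exists>l. joined V E x y l"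
proof -
  have to_vertex: "\<exists>v\<in>V. \<exists>l. joined V E x (vertex_point v) l" if "x \<in> graph_points V E" for x
    using that unfolding graph_points_def
  proof
    assume "x \<in> vertex_point ` V"
    then obtain v where "v \<in> V" "x = vertex_point v" by auto
    then show ?thesis using joined_vertex[of v V E] by auto
  next
    assume "x \<in> (\<Union>e\<in>E. closed_edge e)"
    then obtain e where e: "e \<in> E" "x \<in> closed_edge e" by auto
    then have c: "card e = 2" "e \<subseteq> V" using assms(1) by (auto simp: simple_graph_def)
    then obtain v where v: "v \<in> e" by (auto simp: card_2_iff)
    have "finite e" using c(1) card.infinite by fastforce
    from joined_edge[OF e vertex_point_closed_edge[OF this v]] show ?thesis
      using v c(2) by (intro bexI[of _ v] exI) auto
  qed
  obtain u l v l' where uv: "u \<in> V" "v \<in> V" "joined V E x (vertex_point u) l"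
      "joined V E y (vertex_point v) l'"
    using to_vertex[OF assms(3)] to_vertex[OF assms(4)] by (elim bexE exE)
  obtain l'' where "joined V E (vertex_point u) (vertex_point v) l''"
  proof -
    obtain vs where "is_path V E vs" "hd vs = u" "last vs = v"
      using assms(2) uv(1,2) unfolding connected_graph_def by auto
    then show ?thesis using joined_path[OF assms(1), of vs] that unfolding is_path_def by auto
  qed
  from joined_trans[OF joined_trans[OF joined_sym[OF uv(4)] this] uv(3)] show ?thesis by blast
qed

lemma graph_dist_le: "joined V E x y l \<Longrightarrow> graph_dist V E x y \<le> l"
  unfolding graph_dist_def
  by (auto intro!: cInf_lower bdd_belowI[of _ 0] dest: joined_nonneg)

lemma graph_dist_ge:
  "\<lbrakk>\<exists>l. joined V E x y l; \<And>l. joined V E x y l \<Longrightarrow> c \<le> l\<rbrakk> \<Longrightarrow> c \<le> graph_dist V E x y"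
  unfolding graph_dist_def by (auto intro!: cInf_greatest)

lemma Metric_space_graph_dist:
  assumes "simple_graph V E" "connected_graph V E"
  shows "Metric_space (graph_points V E) (graph_dist V E)"
proof
  fix x y
  show "0 \<le> graph_dist V E x y"
    using graph_dist_ge[of V E x y 0] joined_nonneg unfolding graph_dist_def by fastforce
  then have nonneg: "0 \<le> graph_dist V E x y" .
  have "joined V E x y = joined V E y x"
    using joined_sym[of V E x y] joined_sym[of V E y x] by (intro ext iffI)
  then show "graph_dist V E x y = graph_dist V E y x"
    unfolding graph_dist_def by (simp only:)
  assume xy: "x \<in> graph_points V E" "y \<in> graph_points V E"
  show "graph_dist V E x y = 0 \<longleftrightarrow> x = y"
  proof
    assume 0: "graph_dist V E x y = 0"
    have "\<bar>x v - y v\<bar> \<le> graph_dist V E x y" for v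
      using joined_exists[OF assms xy] joined_coordinate[OF assms(1)] by (intro graph_dist_ge)
    then show "x = y" using 0 by (intro ext) simp
  next
    assume "x = y"
    then show "graph_dist V E x y = 0"
      using nonneg graph_dist_le[OF joined.refl[OF xy(1)]] by auto
  qed
  fix z
  assume z: "z \<in> graph_points V E"
  have "graph_dist V E x z - graph_dist V E x y \<le> graph_dist V E y z"
  proof (rule graph_dist_ge[OF joined_exists[OF assms xy(2) z]])
    fix l assume l: "joined V E y z l"
    have "graph_dist V E x z - l \<le> graph_dist V E x y"
    proof (rule graph_dist_ge[OF joined_exists[OF assms xy]])
      fix l' assume "joined V E x y l'"
      from graph_dist_le[OF joined_trans[OF l this]] show "graph_dist V E x z - l \<le> l'"
        by simp
    qed
    then show "graph_dist V E x z - graph_dist V E x y \<le> l" by simp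
  qed
  then show "graph_dist V E x z \<le> graph_dist V E x y + graph_dist V E y z" by simp
qed

end

theory Submission
  imports Defs
begin

text \<open>
  Let \<open>C\<close> be a cycle of length \<open>L \<ge> 4m\<close>. Every point of \<open>C\<close> is within \<open>1/2\<close> of a vertex, so it
  is enough to find, for each vertex \<open>v\<close> of \<open>C\<close>, a strict shortcut of length at most \<open>m\<close> with an
  end within \<open>m\<close> of \<open>v\<close> along \<open>C\<close> (\<open>shortcut_near_vertex\<close>); since \<open>m \<le> 2m - 1\<close>, one such
  shortcut for each vertex of \<open>C\<close> gives the theorem.

  Number the vertices of \<open>C\<close> cyclically by the integers with \<open>v = c 0\<close>, and let
  \<open>A = {c 0, \<dots>, c (m - 1)}\<close>. A chord of \<open>C\<close> that starts in \<open>A\<close> is itself a strict shortcut of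
  length \<open>1\<close> with an end close to \<open>v\<close>. Without such chords, the only vertices of \<open>C\<close> outside \<open>A\<close> with
  a neighbour in \<open>A\<close> are \<open>p = c (-1)\<close> and \<open>q = c m\<close>. Delete \<open>A\<close> and all its neighbours, and let \<open>D\<close>
  be the component of what is left that contains the rest of \<open>C\<close>. The neighbours of \<open>A\<close> that are
  also neighbours of \<open>D\<close> form a minimal separator, because each of them alone links the connected
  sets \<open>A\<close> and \<open>D\<close> (\<open>minimal_separator_of_connected_set\<close>). It contains \<open>p\<close> and \<open>q\<close>, so by
  hypothesis a walk of length at most \<open>m\<close> leads from \<open>p\<close> to \<open>q\<close>, whereas along \<open>C\<close> these two vertices
  are further than \<open>m\<close> apart: the two arcs have lengths \<open>m + 1\<close> and \<open>L - m - 1 \<ge> 3m - 1\<close>.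

  This walk may meet \<open>C\<close> on its way. Up to the first piece of it that is shorter than the
  way along \<open>C\<close>, it saves nothing over \<open>C\<close>, so that piece starts within \<open>m - 1\<close> of \<open>p\<close> along \<open>C\<close>
  (\<open>first_strict_shortcut\<close>), hence within \<open>m\<close> of \<open>v\<close>. That \<open>p\<close> is adjacent to \<open>v\<close>, instead of
  the arc \<open>A\<close> being centred at \<open>v\<close>, is what makes these bounds add up.

  Two translations connect this combinatorial argument with the metric and topological notions
  of the statement: distances between vertices count steps (\<open>graph_dist_vertices_le_iff\<close>), and
  separation of points by a set of vertices can be tested on edges (\<open>ab_separator_boundary\<close>,
  \<open>connected_avoiding_walk\<close>).
\<close>

section \<open>Points of the graph\<close>

lemma simple_graph_edgeE:
  assumes "simple_graph V E" "e \<in> E"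
  obtains u w where "e = {u, w}" "u \<noteq> w" "u \<in> V" "w \<in> V"
  using assms unfolding simple_graph_def by (metis card_2_iff insert_subset)

lemma closed_edge_pair:
  assumes "u \<noteq> w"
  shows "x \<in> closed_edge {u, w} \<longleftrightarrow>
    0 \<le> x u \<and> 0 \<le> x w \<and> x u + x w = 1 \<and> (\<forall>v. v \<noteq> u \<longrightarrow> v \<noteq> w \<longrightarrow> x v = 0)"
  using assms unfolding closed_edge_def by auto

lemma edge_dist_pair:
  assumes "u \<noteq> w" "x \<in> closed_edge {u, w}" "y \<in> closed_edge {u, w}"
  shows "edge_dist {u, w} x y = \<bar>x u - y u\<bar>"
  using assms by (auto simp: edge_dist_def closed_edge_pair)

text \<open>The two cases exclude each other: a point of an edge with a vanishing coordinate is an end of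
  that edge.\<close>

lemma graph_point_cases:
  assumes "simple_graph V E" "x \<in> graph_points V E"
  obtains (vertex) v where "v \<in> V" "x = vertex_point v"
  | (interior) u w where "{u, w} \<in> E" "u \<noteq> w" "x \<in> closed_edge {u, w}" "0 < x u" "0 < x w"
proof (cases "x \<in> vertex_point ` V")
  case True
  then show ?thesis using vertex by auto
next
  case False
  then obtain e where e: "e \<in> E" "x \<in> closed_edge e"
    using assms(2) by (auto simp: graph_points_def)
  obtain u w where uw: "e = {u, w}" "u \<noteq> w" "u \<in> V" "w \<in> V"
    using simple_graph_edgeE[OF assms(1) e(1)] .
  note x = e(2)[unfolded uw(1) closed_edge_pair[OF uw(2)]]
  have "x u \<noteq> 0"
  proof
    assume "x u = 0"
    then have "x = vertex_point w" using x by (intro ext) (auto simp: vertex_point_def)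
    then show False using False uw by auto
  qed
  moreover have "x w \<noteq> 0"
  proof
    assume "x w = 0"
    then have "x = vertex_point u" using x by (intro ext) (auto simp: vertex_point_def)
    then show False using False uw by auto
  qed
  ultimately show ?thesis using interior[of u w] e uw x by auto
qed

lemma two_positive_coordinates:
  assumes "simple_graph V E" "x \<in> graph_points V E" "0 < x u" "0 < x w" "u \<noteq> w"
  shows "{u, w} \<in> E" "x \<in> closed_edge {u, w}"
proof -
  from assms(1,2) have "{u, w} \<in> E \<and> x \<in> closed_edge {u, w}"
  proof (cases rule: graph_point_cases)
    case (vertex v)
    then show ?thesis using assms(3-5) by (auto simp: vertex_point_def split: if_splits)
  next
    case (interior a b)
    then have "{a, b} = {u, w}"
      using assms(3-5) by (metis closed_edge_pair insert_commute less_irrefl)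
    then show ?thesis using interior by simp
  qed
  then show "{u, w} \<in> E" "x \<in> closed_edge {u, w}" by auto
qed

lemma vertex_point_inject [simp]: "vertex_point u = vertex_point v \<longleftrightarrow> u = v"
proof
  assume "vertex_point u = vertex_point v"
  then have "vertex_point u u = vertex_point v u" by simp
  then show "u = v" by (simp add: vertex_point_def split: if_splits)
qed simp

lemma near_vertex:
  assumes "simple_graph V E" "x \<in> graph_points V E"
  shows "\<exists>v\<in>V. \<exists>l\<le>1/2. joined V E (vertex_point v) x l"
  using assms
proof (cases rule: graph_point_cases)
  case (vertex v)
  then show ?thesis using joined_vertex[of v V E] by (intro bexI[of _ v] exI[of _ 0]) auto
next
  case (interior u w)
  have *: "\<exists>v\<in>V. \<exists>l\<le>1/2. joined V E (vertex_point v) x l"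
    if "{u, w} \<in> E" "u \<noteq> w" "x \<in> closed_edge {u, w}" "1/2 \<le> x u" for u w
  proof -
    have "vertex_point u \<in> closed_edge {u, w}" by (rule vertex_point_closed_edge) auto
    from joined_edge[OF that(1) this that(3)] edge_dist_pair[OF that(2) this that(3)]
    have "joined V E (vertex_point u) x \<bar>1 - x u\<bar>" by (simp add: vertex_point_def)
    moreover have "x u \<le> 1" using that(3) unfolding closed_edge_pair[OF that(2)] by auto
    moreover have "u \<in> V" using that(1) assms(1) by (auto simp: simple_graph_def)
    ultimately show ?thesis using that(4) by (intro bexI[of _ u] exI[of _ "\<bar>1 - x u\<bar>"]) auto
  qed
  have "x u + x w = 1" using interior by (simp add: closed_edge_pair)
  then have "1/2 \<le> x u \<or> 1/2 \<le> x w" by linarith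
  then show ?thesis
    using *[of u w] *[of w u] interior by (auto simp: insert_commute)
qed

section \<open>The distance between vertices\<close>

definition adj :: "'v set set \<Rightarrow> ('v \<times> 'v) set" where
  "adj E = {(x, y). {x, y} \<in> E}"

definition within_steps :: "'v set set \<Rightarrow> nat \<Rightarrow> 'v \<Rightarrow> 'v \<Rightarrow> bool" where
  "within_steps E k u w \<longleftrightarrow> (\<exists>j\<le>k. (u, w) \<in> adj E ^^ j)"

lemma within_steps_trans: "within_steps E j u v \<Longrightarrow> within_steps E k v w \<Longrightarrow> within_steps E (j + k) u w"
  unfolding within_steps_def by (meson add_mono relpow_trans)

lemma within_steps_refl: "within_steps E k u u"
  unfolding within_steps_def by (auto intro!: exI[of _ 0])

lemma within_steps_mono: "within_steps E j u v \<Longrightarrow> j \<le> k \<Longrightarrow> within_steps E k u v"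
  unfolding within_steps_def by (meson order_trans)

lemma within_steps_edge: "{u, v} \<in> E \<Longrightarrow> within_steps E 1 u v"
  unfolding within_steps_def by (auto intro!: exI[of _ "Suc 0"] simp: adj_def)

lemma joined_relpow:
  assumes "simple_graph V E" "u \<in> V" "(u, w) \<in> adj E ^^ n"
  shows "joined V E (vertex_point u) (vertex_point w) (real n)"
  using assms(3)
proof (induction n arbitrary: w)
  case 0
  then show ?case using joined_vertex[OF assms(2)] by simp
next
  case (Suc n)
  then obtain y where y: "(u, y) \<in> adj E ^^ n" "{y, w} \<in> E" by (auto simp: adj_def)
  have "y \<noteq> w" using y(2) assms(1) by (auto simp: simple_graph_def)
  then have "edge_dist {y, w} (vertex_point y) (vertex_point w) = 1"
    by (simp add: edge_dist_def vertex_point_def)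
  moreover have "joined V E (vertex_point u) (vertex_point w)
      (real n + edge_dist {y, w} (vertex_point y) (vertex_point w))"
    using Suc.IH[OF y(1)] y(2)
    by (rule joined.step) (auto intro: vertex_point_closed_edge)
  ultimately show ?case by (simp add: add.commute)
qed

text \<open>The extension of a function on the vertices to all points that is affine on each edge. It serves
  to bound lengths of curves from below: if the function varies by at most \<open>1\<close> along each edge,
  its extension is \<open>1\<close>-Lipschitz for the length metric.\<close>

definition affine_ext :: "('v \<Rightarrow> real) \<Rightarrow> ('v \<Rightarrow> real) \<Rightarrow> real" where
  "affine_ext f x = (\<Sum>v | x v \<noteq> 0. x v * f v)"

lemma affine_ext_vertex: "affine_ext f (vertex_point v) = f v"
proof -
  have "{w. vertex_point v w \<noteq> 0} = {v}" by (auto simp: vertex_point_def)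
  then show ?thesis by (simp add: affine_ext_def vertex_point_def)
qed

lemma affine_ext_edge:
  assumes "u \<noteq> w" "x \<in> closed_edge {u, w}"
  shows "affine_ext f x = x u * f u + x w * f w"
proof -
  have "affine_ext f x = (\<Sum>v\<in>{u, w}. x v * f v)"
    unfolding affine_ext_def using assms
    by (intro sum.mono_neutral_left) (auto simp: closed_edge_pair)
  then show ?thesis using assms(1) by simp
qed

lemma joined_affine_ext:
  assumes "simple_graph V E" "\<And>u w. {u, w} \<in> E \<Longrightarrow> \<bar>f u - f w\<bar> \<le> 1" "joined V E x y l"
  shows "\<bar>affine_ext f x - affine_ext f y\<bar> \<le> l"
  using assms(3)
proof (induction rule: joined.induct)
  case (step x y l e z)
  obtain u w where uw: "e = {u, w}" "u \<noteq> w"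
    using simple_graph_edgeE[OF assms(1) step.hyps(2)] by metis
  have yz: "y \<in> closed_edge {u, w}" "z \<in> closed_edge {u, w}" using step.hyps uw by auto
  have "y w = 1 - y u" "z w = 1 - z u" using yz uw(2) by (auto simp: closed_edge_pair)
  then have "affine_ext f y - affine_ext f z = (y u - z u) * (f u - f w)"
    unfolding affine_ext_edge[OF uw(2) yz(1)] affine_ext_edge[OF uw(2) yz(2)]
    by (simp only:) (simp add: algebra_simps)
  then have "\<bar>affine_ext f y - affine_ext f z\<bar> = \<bar>y u - z u\<bar> * \<bar>f u - f w\<bar>"
    by (simp add: abs_mult)
  also have "\<dots> \<le> \<bar>y u - z u\<bar> * 1"
    using assms(2)[of u w] step.hyps uw by (intro mult_left_mono) auto
  finally have "\<bar>affine_ext f y - affine_ext f z\<bar> \<le> edge_dist e y z"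
    using edge_dist_pair[OF uw(2) yz] uw by simp
  then show ?case using step.IH by linarith
qed simp

text \<open>A curve may turn back inside edges, so its length cannot be compared with a walk directly.
  Instead, the number of steps from \<open>u\<close> varies by at most \<open>1\<close> along each edge, and so its affine
  extension bounds the length of every curve that starts in \<open>u\<close>.\<close>

lemma graph_dist_vertices_le_iff:
  assumes "simple_graph V E" "u \<in> V" "(u, w) \<in> (adj E)\<^sup>*"
  shows "graph_dist V E (vertex_point u) (vertex_point w) \<le> real k \<longleftrightarrow> within_steps E k u w"
proof
  assume "within_steps E k u w"
  then obtain j where "j \<le> k" "(u, w) \<in> adj E ^^ j" unfolding within_steps_def by auto
  then show "graph_dist V E (vertex_point u) (vertex_point w) \<le> real k"
    using graph_dist_le[OF joined_relpow[OF assms(1,2)]] by fastforce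
next
  assume le: "graph_dist V E (vertex_point u) (vertex_point w) \<le> real k"
  define f where "f y = (LEAST n. (u, y) \<in> adj E ^^ n)" for y
  have Suc: "f y \<le> Suc (f x)" if "{x, y} \<in> E" "(u, x) \<in> (adj E)\<^sup>*" for x y
  proof -
    have "(u, x) \<in> adj E ^^ f x"
      using that(2) unfolding f_def by (meson LeastI rtrancl_power)
    then have "(u, y) \<in> adj E ^^ Suc (f x)" using that(1) by (auto simp: adj_def)
    then show ?thesis unfolding f_def by (rule Least_le)
  qed
  have lip: "\<bar>real (f x) - real (f y)\<bar> \<le> 1" if "{x, y} \<in> E" for x y
  proof (cases "(u, x) \<in> (adj E)\<^sup>*")
    case True
    moreover have "(u, y) \<in> (adj E)\<^sup>*"
      using True that by (auto simp: adj_def intro: rtrancl_into_rtrancl)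
    ultimately show ?thesis using Suc[of x y] Suc[of y x] that by (auto simp: insert_commute)
  next
    case False
    have "(u, y) \<notin> (adj E)\<^sup>*"
    proof
      assume "(u, y) \<in> (adj E)\<^sup>*"
      then have "(u, x) \<in> (adj E)\<^sup>*"
        using that by (auto simp: adj_def insert_commute intro: rtrancl_into_rtrancl)
      then show False using False by simp
    qed
    \<comment> \<open>Outside the component of \<open>u\<close> both values are the \<open>LEAST\<close> of an unsatisfiable predicate.\<close>
    then have "f x = f y" unfolding f_def using False by (metis relpow_imp_rtrancl)
    then show ?thesis by simp
  qed
  obtain n where n: "(u, w) \<in> adj E ^^ n" using assms(3) by (auto simp: rtrancl_power)
  have "real (f w) \<le> graph_dist V E (vertex_point u) (vertex_point w)"
  proof (rule graph_dist_ge)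
    show "\<exists>l. joined V E (vertex_point u) (vertex_point w) l"
      using joined_relpow[OF assms(1,2) n] by blast
    fix l assume "joined V E (vertex_point u) (vertex_point w) l"
    from joined_affine_ext[OF assms(1) lip this]
    have "\<bar>real (f u) - real (f w)\<bar> \<le> l" by (simp add: affine_ext_vertex)
    moreover have "f u = 0" unfolding f_def by (intro Least_eq_0) simp
    ultimately show "real (f w) \<le> l" by simp
  qed
  then have "f w \<le> k" using le by linarith
  moreover have "(u, w) \<in> adj E ^^ f w" using n unfolding f_def by (rule LeastI)
  ultimately show "within_steps E k u w" unfolding within_steps_def by blast
qed

lemma walk_edges_rtrancl:
  assumes "walk_edges vs \<subseteq> E" "vs \<noteq> []"
  shows "(hd vs, last vs) \<in> (adj E)\<^sup>*"
proof -
  have "(vs ! 0, vs ! i) \<in> (adj E)\<^sup>*" if "i < length vs" for i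
    using that
  proof (induction i)
    case (Suc i)
    have "{vs ! i, vs ! Suc i} \<in> E" using Suc.prems assms(1) by (auto simp: walk_edges_def)
    then show ?case using Suc by (auto simp: adj_def intro: rtrancl_into_rtrancl)
  qed simp
  from this[of "length vs - 1"] show ?thesis
    using assms(2) by (simp add: hd_conv_nth last_conv_nth)
qed

lemma connected_graph_rtrancl:
  "connected_graph V E \<Longrightarrow> u \<in> V \<Longrightarrow> v \<in> V \<Longrightarrow> (u, v) \<in> (adj E)\<^sup>*"
  unfolding connected_graph_def is_path_def by (metis walk_edges_rtrancl)

section \<open>Separators\<close>

lemma openin_positive_coordinate:
  assumes "simple_graph V E" "connected_graph V E"
  shows "openin (graph_topology V E) {x \<in> graph_points V E. 0 < x v}"
proof -
  interpret Metric_space "graph_points V E" "graph_dist V E"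
    by (rule Metric_space_graph_dist[OF assms])
  show ?thesis unfolding graph_topology_def openin_mtopology
  proof (intro conjI ballI allI impI)
    fix x assume x: "x \<in> {x \<in> graph_points V E. 0 < x v}"
    have "mball x (x v) \<subseteq> {x \<in> graph_points V E. 0 < x v}"
    proof
      fix y assume y: "y \<in> mball x (x v)"
      then have "\<bar>x v - y v\<bar> \<le> graph_dist V E x y"
        using joined_exists[OF assms] joined_coordinate[OF assms(1)]
        by (intro graph_dist_ge) auto
      then show "y \<in> {x \<in> graph_points V E. 0 < x v}" using y by auto
    qed
    then show "\<exists>r>0. mball x r \<subseteq> {x \<in> graph_points V E. 0 < x v}" using x by auto
  qed auto
qed

text \<open>The coordinates are continuous, so the points with a positive coordinate in \<open>K\<close> form an open
  set. The other points, except those of \<open>S\<close> itself, lie in an open set disjoint from it: such a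
  point has a positive coordinate outside \<open>K \<union> S\<close> or lies inside an edge between two vertices
  of \<open>S\<close>.\<close>

lemma ab_separator_boundary:
  assumes G: "simple_graph V E" "connected_graph V E"
    and S: "S \<subseteq> V" and K: "K \<subseteq> V - S" and ab: "a \<in> V - S - K" "b \<in> K"
    and bd: "\<And>u w. {u, w} \<in> E \<Longrightarrow> u \<in> K \<Longrightarrow> w \<in> K \<union> S"
  shows "ab_separator V E a b S"
proof -
  let ?P = "graph_points V E"
  let ?pos = "\<lambda>v. {x \<in> ?P. 0 < x v}"
  define U where "U = (\<Union>v\<in>K. ?pos v)"
  define W where "W = (\<Union>w\<in>V - S - K. ?pos w) \<union>
    (\<Union>(u, w)\<in>{(u, w). u \<in> S \<and> w \<in> S \<and> u \<noteq> w}. ?pos u \<inter> ?pos w)"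
  note op = openin_positive_coordinate[OF G]
  have oU: "openin (graph_topology V E) U" unfolding U_def using op by auto
  have oW: "openin (graph_topology V E) W" unfolding W_def
    using op by (intro openin_Un openin_Union) auto
  have disj: "U \<inter> W = {}"
  proof (rule ccontr)
    assume "U \<inter> W \<noteq> {}"
    then obtain x where x: "x \<in> U" "x \<in> W" by auto
    then obtain v where v: "v \<in> K" "x \<in> ?P" "0 < x v" unfolding U_def by auto
    from x(2) show False unfolding W_def
    proof
      assume "x \<in> (\<Union>w\<in>V - S - K. ?pos w)"
      then obtain w where w: "w \<in> V - S - K" "0 < x w" by auto
      then have "{v, w} \<in> E" using two_positive_coordinates[OF G(1) v(2,3) w(2)] v(1) by auto
      then show False using bd v(1) w by blast
    next
      assume "x \<in> (\<Union>(u, w)\<in>{(u, w). u \<in> S \<and> w \<in> S \<and> u \<noteq> w}. ?pos u \<inter> ?pos w)"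
      then obtain u w where uw: "u \<in> S" "w \<in> S" "u \<noteq> w" "0 < x u" "0 < x w" by auto
      then have "x \<in> closed_edge {u, w}"
        using two_positive_coordinates[OF G(1) v(2), of u w] by auto
      moreover have "v \<noteq> u" "v \<noteq> w" using v K uw by auto
      ultimately show False using v(3) uw(3) by (auto simp: closed_edge_pair)
    qed
  qed
  have cover: "x \<in> U \<union> W" if x: "x \<in> ?P - vertex_point ` S" for x
  proof -
    have "x \<in> ?P" using x by simp
    with G(1) show ?thesis
    proof (cases rule: graph_point_cases)
      case (vertex v)
      then have "v \<in> V - S" "0 < x v" using x by (auto simp: vertex_point_def)
      then show ?thesis using x unfolding U_def W_def by auto
    next
      case (interior u w)
      moreover have "u \<in> V" "w \<in> V" using interior(1) G(1) by (auto simp: simple_graph_def)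
      moreover have "u \<in> K \<or> w \<in> K \<or> u \<in> V - S - K \<or> w \<in> V - S - K \<or> u \<in> S \<and> w \<in> S"
        using \<open>u \<in> V\<close> \<open>w \<in> V\<close> by blast
      ultimately consider "u \<in> K" | "w \<in> K" | "u \<in> V - S - K" | "w \<in> V - S - K"
        | "u \<in> S" "w \<in> S"
        by blast
      then show ?thesis
        using \<open>x \<in> ?P\<close> \<open>0 < x u\<close> \<open>0 < x w\<close> \<open>u \<noteq> w\<close>
        unfolding U_def W_def by cases blast+
    qed
  qed
  have "\<not> connected_component_of (subtopology (graph_topology V E) (?P - vertex_point ` S))
           (vertex_point a) (vertex_point b)"
  proof
    assume "connected_component_of (subtopology (graph_topology V E) (?P - vertex_point ` S))
           (vertex_point a) (vertex_point b)"
    then obtain T where T: "connectedin (graph_topology V E) T" "T \<subseteq> ?P - vertex_point ` S"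
      "vertex_point a \<in> T" "vertex_point b \<in> T"
      unfolding connected_component_of_def by (auto simp: connectedin_subtopology)
    have "vertex_point a \<in> W" "vertex_point b \<in> U"
      using ab T unfolding U_def W_def by (auto simp: vertex_point_def)
    then have "U \<inter> T \<noteq> {}" "W \<inter> T \<noteq> {}" using T by auto
    moreover have "T \<subseteq> U \<union> W" using cover T(2) by auto
    moreover have "U \<inter> W \<inter> T = {}" using disj by auto
    ultimately show False using T(1) oU oW unfolding connectedin by blast
  qed
  then show ?thesis using S K ab unfolding ab_separator_def by auto
qed

text \<open>Barycentric coordinates parametrize an edge by the unit interval without stretching
  distances.\<close>

lemma connectedin_closed_edge:
  assumes G: "simple_graph V E" "connected_graph V E" and e: "e \<in> E"
  shows "connectedin (graph_topology V E) (closed_edge e)"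
proof -
  interpret Metric_space "graph_points V E" "graph_dist V E"
    by (rule Metric_space_graph_dist[OF G])
  obtain u w where uw: "e = {u, w}" "u \<noteq> w" using simple_graph_edgeE[OF G(1) e] by metis
  define g where "g t = (\<lambda>v. if v = u then t else if v = w then 1 - t else (0::real))" for t
  have g: "g t \<in> closed_edge e" if "t \<in> {0..1}" for t
    using that uw by (auto simp: closed_edge_pair g_def)
  have d: "graph_dist V E (g s) (g t) \<le> \<bar>s - t\<bar>" if "s \<in> {0..1}" "t \<in> {0..1}" for s t
    using graph_dist_le[OF joined_edge[OF e g g], of s t V] that
      edge_dist_pair[OF uw(2)] g uw by (auto simp: g_def)
  have P: "closed_edge e \<subseteq> graph_points V E" using e by (auto simp: graph_points_def)
  have "continuous_map (top_of_set {0..1}) mtopology g"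
    unfolding continuous_map_to_metric
  proof (intro ballI allI impI)
    fix t :: real and \<epsilon> :: real assume t: "t \<in> topspace (top_of_set {0..1})" and \<epsilon>: "0 < \<epsilon>"
    show "\<exists>U. openin (top_of_set {0..1}) U \<and> t \<in> U \<and> (\<forall>y\<in>U. g y \<in> mball (g t) \<epsilon>)"
    proof (intro exI conjI ballI)
      show "openin (top_of_set {0..1}) ({0..1} \<inter> ball t \<epsilon>)" by (intro openin_open_Int) simp
      show "t \<in> {0..1} \<inter> ball t \<epsilon>" using t \<epsilon> by auto
      fix y assume "y \<in> {0..1} \<inter> ball t \<epsilon>"
      then show "g y \<in> mball (g t) \<epsilon>"
        using d[of t y] g[of t] g[of y] t P by (auto simp: dist_real_def)
    qed
  qed
  then have "connectedin mtopology (g ` {0..1})"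
    by (rule connectedin_continuous_map_image) (simp add: connectedin_subtopology)
  moreover have "g ` {0..1} = closed_edge e"
  proof
    show "closed_edge e \<subseteq> g ` {0..1}"
    proof
      fix x assume x: "x \<in> closed_edge e"
      then have "x = g (x u)" "x u \<in> {0..1}" using uw by (auto simp: closed_edge_pair g_def)
      then show "x \<in> g ` {0..1}" by blast
    qed
  qed (use g in auto)
  ultimately show ?thesis by (simp add: graph_topology_def)
qed

lemma connected_avoiding_walk:
  assumes G: "simple_graph V E" "connected_graph V E" and u: "u \<in> V - T"
    and walk: "(u, w) \<in> {(x, y). {x, y} \<in> E \<and> x \<notin> T \<and> y \<notin> T}\<^sup>*"
  shows "connected_component_of
           (subtopology (graph_topology V E) (graph_points V E - vertex_point ` T))
           (vertex_point u) (vertex_point w)"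
  using walk
proof (induction rule: rtrancl_induct)
  case base
  interpret Metric_space "graph_points V E" "graph_dist V E"
    by (rule Metric_space_graph_dist[OF G])
  have "vertex_point u \<in> graph_points V E" using u by (auto simp: graph_points_def)
  then show ?case using u by (auto simp: connected_component_of_refl graph_topology_def)
next
  case (step y z)
  then have yz: "{y, z} \<in> E" "y \<notin> T" "z \<notin> T" by auto
  have "closed_edge {y, z} \<subseteq> graph_points V E - vertex_point ` T"
  proof -
    have "vertex_point t \<notin> closed_edge {y, z}" if "t \<in> T" for t
    proof -
      have "t \<notin> {y, z}" "vertex_point t t \<noteq> 0" using yz that by (auto simp: vertex_point_def)
      then show ?thesis unfolding closed_edge_def by blast
    qed
    then show ?thesis using yz by (auto simp: graph_points_def)
  qed
  then have "connectedin (subtopology (graph_topology V E) (graph_points V E - vertex_point ` T))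
      (closed_edge {y, z})"
    using connectedin_closed_edge[OF G yz(1)] by (simp add: connectedin_subtopology)
  moreover have "vertex_point y \<in> closed_edge {y, z}" "vertex_point z \<in> closed_edge {y, z}"
    by (auto intro: vertex_point_closed_edge)
  ultimately have "connected_component_of
      (subtopology (graph_topology V E) (graph_points V E - vertex_point ` T))
      (vertex_point y) (vertex_point z)"
    unfolding connected_component_of_def by blast
  with step.IH show ?case by (rule connected_component_of_trans)
qed

text \<open>Here \<open>F\<close> is what is left after deleting \<open>A\<close> and its neighbours, and \<open>D\<close> is the component of \<open>b\<close>
  in \<open>F\<close>. An edge that leaves \<open>D\<close> cannot end in \<open>A\<close>, so it ends in a neighbour of \<open>A\<close>, that is, in \<open>S\<close>.
  Conversely, if any \<open>s \<in> S\<close> is put back, \<open>a\<close> reaches \<open>b\<close> through \<open>A\<close>, \<open>s\<close> and \<open>D\<close>. The separator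
  is thus minimal by construction, and no minimal one has to be chosen among possibly infinite
  sets.\<close>

lemma minimal_separator_of_connected_set:
  fixes A F :: "'v set"
  assumes G: "simple_graph V E" "connected_graph V E"
    and A: "A \<subseteq> V" "a \<in> A" "\<And>x. x \<in> A \<Longrightarrow> (a, x) \<in> {(x, y). {x, y} \<in> E \<and> x \<in> A \<and> y \<in> A}\<^sup>*"
    and F: "F = {x \<in> V - A. \<forall>z\<in>A. {z, x} \<notin> E}" and b: "b \<in> F"
    and D: "D = {y. (b, y) \<in> {(x, y). {x, y} \<in> E \<and> x \<in> F \<and> y \<in> F}\<^sup>*}"
    and S: "S = {s \<in> V - A. (\<exists>z\<in>A. {z, s} \<in> E) \<and> (\<exists>d\<in>D. {d, s} \<in> E)}"
  shows "minimal_ab_separator V E a b S"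
proof -
  have DF: "D \<subseteq> F"
  proof
    fix y assume "y \<in> D"
    then have "(b, y) \<in> {(x, y). {x, y} \<in> E \<and> x \<in> F \<and> y \<in> F}\<^sup>*" using D by simp
    then show "y \<in> F" using b by (induction rule: rtrancl_induct) auto
  qed
  have "ab_separator V E a b S"
  proof (rule ab_separator_boundary[OF G, where K = D])
    show "S \<subseteq> V" "D \<subseteq> V - S" using S DF F by auto
    show "a \<in> V - S - D" using A DF S F by auto
    show "b \<in> D" using D by simp
    fix u w assume e: "{u, w} \<in> E" and u: "u \<in> D"
    have w: "w \<in> V" using e G(1) by (auto simp: simple_graph_def)
    have "w \<notin> A" using e u DF F by (auto simp: insert_commute)
    show "w \<in> D \<union> S"
    proof (cases "w \<in> F")
      case True
      then have "w \<in> D" using u e DF D by (auto intro: rtrancl_into_rtrancl)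
      then show ?thesis by simp
    next
      case False
      then show ?thesis using w \<open>w \<notin> A\<close> F S u e by auto
    qed
  qed
  moreover have "\<not> ab_separator V E a b T" if T: "T \<subset> S" for T
  proof -
    obtain s where s: "s \<in> S" "s \<notin> T" using T by auto
    let ?R = "{(x, y). {x, y} \<in> E \<and> x \<notin> T \<and> y \<notin> T}"
    have dis: "A \<inter> T = {}" "F \<inter> T = {}" using T S F by auto
    obtain z d where zd: "z \<in> A" "{z, s} \<in> E" "d \<in> D" "{d, s} \<in> E" using s S by auto
    have "(a, z) \<in> ?R\<^sup>*"
      using A(3)[OF zd(1)] by (rule rtrancl_mono[THEN subsetD, rotated]) (use dis in auto)
    moreover have "(z, s) \<in> ?R" "(s, d) \<in> ?R"
      using zd s dis DF by (auto simp: insert_commute)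
    moreover have "(b, d) \<in> ?R\<^sup>*"
      using zd(3)[unfolded D mem_Collect_eq]
      by (rule rtrancl_mono[THEN subsetD, rotated]) (use dis in auto)
    moreover have "sym ?R" by (auto simp: sym_def insert_commute)
    ultimately have "(a, b) \<in> ?R\<^sup>*"
      by (meson rtrancl.rtrancl_into_rtrancl rtrancl_trans sym_rtrancl symD)
    moreover have "a \<in> V - T" using A dis by auto
    ultimately show ?thesis
      using connected_avoiding_walk[OF G] unfolding ab_separator_def by blast
  qed
  ultimately show ?thesis unfolding minimal_ab_separator_def by auto
qed

section \<open>Cycles\<close>

text \<open>Labels range over all integers, so that rotating a cycle is a translation of the labels and
  steps in both directions need no reduction modulo the length.\<close>

definition cyclic_labelling :: "'v list \<Rightarrow> (int \<Rightarrow> 'v) \<Rightarrow> bool" where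
  "cyclic_labelling C c \<longleftrightarrow>
     set C = range c \<and> walk_edges C = range (\<lambda>i. {c i, c (i + 1)}) \<and>
     (\<forall>i j. c i = c j \<longleftrightarrow> i mod int (walk_length C) = j mod int (walk_length C))"

lemma cycle_has_labelling:
  assumes "is_cycle V E C" "v \<in> set C"
  shows "\<exists>c. cyclic_labelling C c \<and> c 0 = v"
proof -
  define L where "L = walk_length C"
  have len: "length C = Suc L" and L: "3 \<le> L"
    using assms(1) by (auto simp: is_cycle_def walk_length_def L_def)
  have close: "C ! L = C ! 0"
    using assms(1) len L by (metis diff_Suc_1 hd_conv_nth is_cycle_def last_conv_nth list.size(3) nat.distinct(1))
  have inj: "C ! i = C ! j \<longleftrightarrow> i = j" if "i < L" "j < L" for i j
  proof -
    have dist: "distinct (tl C)" using assms(1) by (simp add: is_cycle_def)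
    have tl: "tl C ! k = C ! Suc k" if "k < L" for k
      using that len by (simp add: nth_tl)
    \<comment> \<open>\<open>tl C\<close> lists each vertex once, with the starting vertex at the end.\<close>
    define g where "g i = (if i = 0 then L - 1 else i - 1)" for i
    have "C ! i = tl C ! g i" "g i < L" if "i < L" for i
      using that tl[of "g i"] close L by (auto simp: g_def)
    then have "C ! i = C ! j \<longleftrightarrow> g i = g j"
      using dist len that by (simp add: nth_eq_iff_index_eq)
    also have "\<dots> \<longleftrightarrow> i = j" using that L by (auto simp: g_def split: if_splits)
    finally show ?thesis .
  qed
  define c where "c i = C ! nat (i mod int L)" for i
  have c_nat: "c (int i) = C ! i" if "i \<le> L" for i
    using that close L by (cases "i = L") (auto simp: c_def)
  have repr: "\<exists>k<L. i mod int L = int k" for i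
    using L by (intro exI[of _ "nat (i mod int L)"]) (auto simp: nat_less_iff)
  have c_eq: "c i = c j \<longleftrightarrow> i mod int L = j mod int L" for i j
    using repr[of i] repr[of j] inj by (auto simp: c_def)
  have set: "set C = range c"
  proof
    show "set C \<subseteq> range c" using c_nat len by (auto simp: in_set_conv_nth less_Suc_eq_le) (metis rangeI)
    show "range c \<subseteq> set C"
    proof
      fix x assume "x \<in> range c"
      then obtain i where "x = c i" by auto
      moreover obtain k where "k < L" "i mod int L = int k" using repr by blast
      ultimately show "x \<in> set C" using len by (auto simp: c_def)
    qed
  qed
  have edges: "walk_edges C = range (\<lambda>i. {c i, c (i + 1)})"
  proof
    show "walk_edges C \<subseteq> range (\<lambda>i. {c i, c (i + 1)})"
    proof
      fix e assume "e \<in> walk_edges C"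
      then obtain i where "i < L" "e = {C ! i, C ! Suc i}" using len by (auto simp: walk_edges_def)
      then have "e = {c (int i), c (int i + 1)}"
        using c_nat[of i] c_nat[of "Suc i"] by (simp add: add.commute)
      then show "e \<in> range (\<lambda>i. {c i, c (i + 1)})" by blast
    qed
    show "range (\<lambda>i. {c i, c (i + 1)}) \<subseteq> walk_edges C"
    proof
      fix e assume "e \<in> range (\<lambda>i. {c i, c (i + 1)})"
      then obtain i where e: "e = {c i, c (i + 1)}" by auto
      obtain k where k: "k < L" "i mod int L = int k" using repr by blast
      have "c i = c (int k)" "c (i + 1) = c (int k + 1)"
        using k by (auto simp: c_eq) (metis mod_add_left_eq)
      then have "e = {C ! k, C ! Suc k}"
        using e c_nat[of k] c_nat[of "Suc k"] k by (simp add: add.commute)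
      then show "e \<in> walk_edges C" using k len by (auto simp: walk_edges_def)
    qed
  qed
  obtain k where k: "v = c k" using assms(2) set by auto
  have shift: "range (\<lambda>i. h (i + k)) = range h" for h :: "int \<Rightarrow> 'b"
  proof -
    have "h i = h (i - k + k)" for i by simp
    then show ?thesis by blast
  qed
  have "cyclic_labelling C (\<lambda>i. c (i + k))"
    unfolding cyclic_labelling_def
  proof (intro conjI allI)
    show "set C = range (\<lambda>i. c (i + k))" using set shift[of c] by simp
    show "walk_edges C = range (\<lambda>i. {c (i + k), c (i + 1 + k)})"
      using edges shift[of "\<lambda>i. {c i, c (i + 1)}"] by (simp add: algebra_simps)
    show "c (i + k) = c (j + k) \<longleftrightarrow> i mod int (walk_length C) = j mod int (walk_length C)" for i j
      unfolding c_eq L_def[symmetric] by (simp add: mod_eq_dvd_iff)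
  qed
  then show ?thesis using k by (intro exI[of _ "\<lambda>i. c (i + k)"]) simp
qed

lemma labelling_neq:
  assumes "cyclic_labelling C c" "i < j" "j < i + int (walk_length C)"
  shows "c i \<noteq> c j"
proof
  assume "c i = c j"
  then have "int (walk_length C) dvd j - i"
    using assms(1) by (metis cyclic_labelling_def mod_eq_dvd_iff)
  then have "int (walk_length C) \<le> j - i" using assms(2) by (intro zdvd_imp_le) auto
  then show False using assms(3) by linarith
qed

lemma labelling_edge_iff:
  assumes "cyclic_labelling C c"
  shows "{c i, y} \<in> walk_edges C \<longleftrightarrow> y = c (i + 1) \<or> y = c (i - 1)"
proof
  have c: "walk_edges C = range (\<lambda>i. {c i, c (i + 1)})" 
      "c i = c j \<longleftrightarrow> i mod int (walk_length C) = j mod int (walk_length C)" for i j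
    using assms unfolding cyclic_labelling_def by auto
  have shift: "c (i + d) = c (j + d)" if "c i = c j" for i j d
    using that unfolding c(2) by (metis mod_add_left_eq)
  {
    assume "{c i, y} \<in> walk_edges C"
    then obtain k where "{c i, y} = {c k, c (k + 1)}" using c(1) by auto
    then have "c i = c k \<and> y = c (k + 1) \<or> c i = c (k + 1) \<and> y = c k" by (auto simp: doubleton_eq_iff)
    then show "y = c (i + 1) \<or> y = c (i - 1)"
      using shift[of i k 1] shift[of i "k + 1" "-1"] by auto
  next
    assume "y = c (i + 1) \<or> y = c (i - 1)"
    then show "{c i, y} \<in> walk_edges C"
    proof
      assume "y = c (i - 1)"
      then have "{c i, y} = {c (i - 1), c (i - 1 + 1)}" by auto
      then show ?thesis unfolding c(1) by blast
    qed (auto simp: c(1))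
  }
qed

lemma labelling_within_steps:
  assumes "cyclic_labelling C c"
  shows "within_steps (walk_edges C) k (c i) y \<longleftrightarrow> (\<exists>j. \<bar>j - i\<bar> \<le> int k \<and> y = c j)"
proof
  have "\<exists>j. \<bar>j - i\<bar> \<le> int n \<and> y = c j" if "(c i, y) \<in> adj (walk_edges C) ^^ n" for n
    using that
  proof (induction n arbitrary: y)
    case 0
    then show ?case by (intro exI[of _ i]) auto
  next
    case (Suc n)
    then obtain x where x: "(c i, x) \<in> adj (walk_edges C) ^^ n" "{x, y} \<in> walk_edges C"
      by (auto simp: adj_def)
    obtain j where j: "\<bar>j - i\<bar> \<le> int n" "x = c j" using Suc.IH[OF x(1)] by auto
    then have "y = c (j + 1) \<or> y = c (j - 1)" using x(2) labelling_edge_iff[OF assms] by auto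
    moreover have "\<bar>j + 1 - i\<bar> \<le> int (Suc n)" "\<bar>j - 1 - i\<bar> \<le> int (Suc n)" using j(1) by auto
    ultimately show ?case by blast
  qed
  then show "within_steps (walk_edges C) k (c i) y \<Longrightarrow> \<exists>j. \<bar>j - i\<bar> \<le> int k \<and> y = c j"
    unfolding within_steps_def by (meson of_nat_mono order_trans)
  have pos: "(c i, c (i + int n)) \<in> adj (walk_edges C) ^^ n" for i n
  proof (induction n)
    case (Suc n)
    then show ?case using labelling_edge_iff[OF assms, of "i + int n" "c (i + int n + 1)"]
      by (auto simp: adj_def algebra_simps)
  qed simp
  have neg: "(c i, c (i - int n)) \<in> adj (walk_edges C) ^^ n" for i n
  proof (induction n)
    case (Suc n)
    then show ?case using labelling_edge_iff[OF assms, of "i - int n" "c (i - int n - 1)"]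
      by (auto simp: adj_def algebra_simps)
  qed simp
  assume "\<exists>j. \<bar>j - i\<bar> \<le> int k \<and> y = c j"
  then obtain j where j: "\<bar>j - i\<bar> \<le> int k" "y = c j" by auto
  have "(c i, c j) \<in> adj (walk_edges C) ^^ nat \<bar>j - i\<bar>"
    using pos[of i "nat \<bar>j - i\<bar>"] neg[of i "nat \<bar>j - i\<bar>"] by (cases "i \<le> j") auto
  moreover have "nat \<bar>j - i\<bar> \<le> k" using j(1) by auto
  ultimately show "within_steps (walk_edges C) k (c i) y"
    unfolding within_steps_def j(2) by blast
qed

lemma cycle_vertices_reachable:
  assumes "is_cycle V E C" "u \<in> set C" "w \<in> set C"
  shows "(u, w) \<in> (adj (walk_edges C))\<^sup>*"
proof -
  obtain c where c: "cyclic_labelling C c" "c 0 = u" using cycle_has_labelling[OF assms(1,2)] by auto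
  then obtain j where "w = c j" using assms(3) unfolding cyclic_labelling_def by auto
  then have "within_steps (walk_edges C) (nat \<bar>j\<bar>) (c 0) w"
    unfolding labelling_within_steps[OF c(1)] by auto
  then show ?thesis unfolding within_steps_def c(2) by (auto intro: relpow_imp_rtrancl)
qed

lemma simple_graph_cycle:
  assumes "simple_graph V E" "is_cycle V E C"
  shows "simple_graph (set C) (walk_edges C)"
proof -
  have "e \<subseteq> set C" if "e \<in> walk_edges C" for e
    using that by (auto simp: walk_edges_def)
  then show ?thesis using assms unfolding simple_graph_def is_cycle_def by blast
qed

lemma cycle_dist_le_iff:
  assumes "simple_graph V E" "is_cycle V E C" "u \<in> set C" "w \<in> set C"
  shows "cycle_dist C (vertex_point u) (vertex_point w) \<le> real k \<longleftrightarrow>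
    within_steps (walk_edges C) k u w"
  unfolding cycle_dist_def
  using graph_dist_vertices_le_iff[OF simple_graph_cycle[OF assms(1,2)] assms(3)
      cycle_vertices_reachable[OF assms(2-4)]] .

section \<open>Strict shortcuts\<close>

text \<open>Strictness also concerns interior points of edges: a common interior point of the walk and
  of \<open>C\<close> would lie on a common edge, whose two ends must be the two ends of the walk. Then the
  walk would be a single edge of \<open>C\<close>, which is no shortcut.\<close>

lemma strict_shortcut_of_walk:
  assumes G: "simple_graph V E" "is_cycle V E C"
    and f: "inj_on f {..n}" "f 0 \<in> V" "\<And>i. i < n \<Longrightarrow> {f i, f (Suc i)} \<in> E"
    and ends: "f 0 \<in> set C" "f n \<in> set C"
    and between: "\<And>i. 0 < i \<Longrightarrow> i < n \<Longrightarrow> f i \<notin> set C"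
    and far: "\<not> within_steps (walk_edges C) n (f 0) (f n)"
  shows "strict_shortcut V E C (map f [0..<Suc n])"
proof -
  let ?\<sigma> = "map f [0..<Suc n]"
  have set: "set ?\<sigma> = f ` {..n}" by (simp add: atLeast0LessThan lessThan_Suc_atMost del: upt_Suc)
  have edges: "walk_edges ?\<sigma> = {{f i, f (Suc i)} | i. i < n}"
  proof -
    have "?\<sigma> ! i = f i" if "i \<le> n" for i using that by (simp add: nth_append less_Suc_eq_le del: upt_Suc)
    then have "{?\<sigma> ! i, ?\<sigma> ! Suc i} = {f i, f (Suc i)}" if "i < n" for i using that by simp
    moreover have "length ?\<sigma> = Suc n" by simp
    ultimately show ?thesis unfolding walk_edges_def by (metis (no_types, lifting) Suc_less_eq)
  qed
  have hd: "hd ?\<sigma> = f 0" by (simp add: hd_map del: upt_Suc)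
  have last: "last ?\<sigma> = f n" by simp
  have V: "f i \<in> V" if "i \<le> n" for i
    using that f(2) f(3)[of "i - 1"] G(1) by (cases i) (auto simp: simple_graph_def)
  have path: "is_path V E ?\<sigma>"
    unfolding is_path_def set edges using V f
    by (auto simp: distinct_map inj_on_def simp del: upt_Suc)
  have "real n < cycle_dist C (vertex_point (f 0)) (vertex_point (f n))"
    using cycle_dist_le_iff[OF G ends, of n] far by linarith
  then have short: "shortcut V E C ?\<sigma>"
    unfolding shortcut_def hd last using path ends by (simp add: walk_length_def)
  have pos: "0 < n" using far by (cases n) (auto simp: within_steps_refl)
  have E\<sigma>: "simple_graph (set ?\<sigma>) (walk_edges ?\<sigma>)"
    using G(1) f(3) unfolding set edges simple_graph_def by (auto simp: Suc_le_eq)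
  have "walk_points ?\<sigma> \<inter> walk_points C \<subseteq> {vertex_point (f 0), vertex_point (f n)}"
  proof
    fix x assume x: "x \<in> walk_points ?\<sigma> \<inter> walk_points C"
    then have xC: "x \<in> graph_points (set C) (walk_edges C)" by (simp add: walk_points_def)
    from x have "x \<in> graph_points (set ?\<sigma>) (walk_edges ?\<sigma>)" by (simp add: walk_points_def)
    with E\<sigma> show "x \<in> {vertex_point (f 0), vertex_point (f n)}"
    proof (cases rule: graph_point_cases)
      case (vertex v)
      have "v \<in> set C"
        using simple_graph_cycle[OF G] xC
      proof (cases rule: graph_point_cases)
        case (interior u w)
        then have "v = u" "v = w" using vertex by (auto simp: vertex_point_def split: if_splits)
        then show ?thesis using interior by simp
      qed (use vertex in simp)
      moreover obtain i where "i \<le> n" "v = f i" using vertex unfolding set by auto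
      ultimately have "i = 0 \<or> i = n" using between[of i] by (cases "i = 0"; cases "i = n") auto
      then show ?thesis using vertex \<open>v = f i\<close> by auto
    next
      case (interior u w)
      then have uw: "{u, w} \<in> walk_edges C" "u \<in> set C" "w \<in> set C"
        using two_positive_coordinates[OF simple_graph_cycle[OF G] xC, of u w]
          simple_graph_cycle[OF G] by (auto simp: simple_graph_def)
      obtain i where i: "i < n" "{u, w} = {f i, f (Suc i)}" using interior unfolding edges by auto
      then have "f i \<in> set C" "f (Suc i) \<in> set C" using uw by (metis insertCI insertE singletonD)+
      then have "i = 0" "Suc i = n"
        using between[of i] between[of "Suc i"] i(1)
        by (metis neq0_conv, metis Suc_lessI zero_less_Suc)
      then have "within_steps (walk_edges C) n (f 0) (f n)"
        using within_steps_edge[of "f i" "f (Suc i)" "walk_edges C"] i(2) uw(1) by simp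
      then show ?thesis using far by simp
    qed
  qed
  moreover have "vertex_point (f 0) \<in> walk_points ?\<sigma>" "vertex_point (f n) \<in> walk_points ?\<sigma>"
    unfolding walk_points_def graph_points_def set by auto
  moreover have "vertex_point (f 0) \<in> walk_points C" "vertex_point (f n) \<in> walk_points C"
    unfolding walk_points_def graph_points_def using ends by auto
  ultimately show ?thesis
    unfolding strict_shortcut_def hd last using short by auto
qed

text \<open>A shortest walk visits no vertex twice, since the loop in between could be cut out.\<close>

lemma injective_walk:
  assumes "within_steps E k u w"
  shows "\<exists>n f. n \<le> k \<and> f 0 = u \<and> f n = w \<and> inj_on f {..n} \<and> (\<forall>i<n. {f i, f (Suc i)} \<in> E)"
proof -
  define n where "n = (LEAST n. (u, w) \<in> adj E ^^ n)"
  obtain j where j: "j \<le> k" "(u, w) \<in> adj E ^^ j" using assms unfolding within_steps_def by auto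
  have n: "(u, w) \<in> adj E ^^ n" unfolding n_def using j(2) by (rule LeastI)
  have "n \<le> j" unfolding n_def using j(2) by (rule Least_le)
  obtain f where f: "f 0 = u" "f n = w" "\<And>i. i < n \<Longrightarrow> (f i, f (Suc i)) \<in> adj E"
    using n unfolding relpow_fun_conv by auto
  have seg: "(f a, f b) \<in> adj E ^^ (b - a)" if "a \<le> b" "b \<le> n" for a b
    unfolding relpow_fun_conv using that f(3) by (intro exI[of _ "\<lambda>i. f (a + i)"]) auto
  have "f a \<noteq> f b" if ab: "a < b" "b \<le> n" for a b
  proof
    assume "f a = f b"
    moreover have "(u, f a) \<in> adj E ^^ a" "(f b, w) \<in> adj E ^^ (n - b)"
      using seg[of 0 a] seg[of b n] ab f(1,2) by auto
    ultimately have "(u, w) \<in> adj E ^^ (a + (n - b))" by (auto intro: relpow_trans)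
    then have "n \<le> a + (n - b)" unfolding n_def by (rule Least_le)
    then show False using ab by linarith
  qed
  then have "inj_on f {..n}" by (auto simp: inj_on_def) (metis linorder_neqE_nat)
  then show ?thesis using f j \<open>n \<le> j\<close> by (intro exI[of _ n] exI[of _ f]) (auto simp: adj_def)
qed

text \<open>Let \<open>f j\<close> be the first vertex of \<open>C\<close> on a walk from \<open>p\<close> that is reached in fewer steps than along \<open>C\<close>,
  and \<open>f i\<close> the previous visit to \<open>C\<close>. By the choice of \<open>j\<close>, the vertex \<open>f i\<close> is within \<open>i\<close> of \<open>p\<close>
  along \<open>C\<close>, so the piece from \<open>f i\<close> to \<open>f j\<close> must be the one that saves steps.\<close>

lemma first_strict_shortcut:
  assumes G: "simple_graph V E" "is_cycle V E C"
    and p: "p \<in> set C" and q: "q \<in> set C"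
    and short: "within_steps E k p q" and far: "\<not> within_steps (walk_edges C) k p q"
  shows "\<exists>\<sigma>. strict_shortcut V E C \<sigma> \<and> walk_length \<sigma> \<le> k \<and>
    within_steps (walk_edges C) (k - 1) p (hd \<sigma>)"
proof -
  let ?near = "within_steps (walk_edges C)"
  obtain n f where f: "n \<le> k" "f 0 = p" "f n = q" "inj_on f {..n}"
    "\<And>i. i < n \<Longrightarrow> {f i, f (Suc i)} \<in> E"
    using injective_walk[OF short] by auto
  define P where "P j \<longleftrightarrow> j \<le> n \<and> f j \<in> set C \<and> \<not> ?near j p (f j)" for j
  have "\<not> ?near n p q" using far by (meson f(1) within_steps_mono)
  then have "P n" using f(3) q unfolding P_def by simp
  define j where "j = (LEAST j. P j)"
  have j: "P j" "\<And>i. i < j \<Longrightarrow> \<not> P i"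
    using LeastI[of P n] \<open>P n\<close> not_less_Least unfolding j_def by auto
  have "j \<noteq> 0" using j(1) f(2) within_steps_refl unfolding P_def by metis
  define i where "i = Max {i. i < j \<and> f i \<in> set C}"
  have "0 \<in> {i. i < j \<and> f i \<in> set C}" using \<open>j \<noteq> 0\<close> p f(2) by simp
  then have "i \<in> {i. i < j \<and> f i \<in> set C}" unfolding i_def by (intro Max_in) auto
  then have i: "i < j" "f i \<in> set C" by auto
  have gap: "f l \<notin> set C" if "i < l" "l < j" for l
    using that Max_ge[of "{i. i < j \<and> f i \<in> set C}" l] unfolding i_def by fastforce
  have jn: "j \<le> n" "f j \<in> set C" "\<not> ?near j p (f j)" using j(1) by (auto simp: P_def)
  have pi: "?near i p (f i)" using j(2)[OF i(1)] i jn(1) by (auto simp: P_def)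
  have "strict_shortcut V E C (map (\<lambda>l. f (i + l)) [0..<Suc (j - i)])"
  proof (rule strict_shortcut_of_walk[OF G])
    show "inj_on (\<lambda>l. f (i + l)) {..j - i}" 
    proof (rule inj_onI)
      fix x y assume "x \<in> {..j - i}" "y \<in> {..j - i}" "f (i + x) = f (i + y)"
      then show "x = y" using inj_onD[OF f(4), of "i + x" "i + y"] i jn by auto
    qed
    show "f (i + 0) \<in> V" using i G(2) by (auto simp: is_cycle_def)
    show "\<not> ?near (j - i) (f (i + 0)) (f (i + (j - i)))"
      using within_steps_trans[OF pi, of "j - i" "f j"] i jn by auto
  qed (use f i jn gap in auto)
  moreover have "walk_length (map (\<lambda>l. f (i + l)) [0..<Suc (j - i)]) \<le> k"
    using jn f by (simp add: walk_length_def)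
  moreover have "hd (map (\<lambda>l. f (i + l)) [0..<Suc (j - i)]) = f i"
    by (simp add: hd_map del: upt_Suc)
  moreover have "?near (k - 1) p (f i)"
    using pi by (rule within_steps_mono) (use i jn f in auto)
  ultimately show ?thesis by metis
qed

section \<open>A shortcut near every vertex\<close>

lemma shortcut_near_vertex:
  assumes G: "simple_graph V E" "connected_graph V E" and m: "m \<ge> 1"
    and sep: "\<And>S. minimal_vertex_separator V E S \<Longrightarrow> vertex_set_diam V E S \<le> of_nat m"
    and C: "is_cycle V E C" "4 * m \<le> walk_length C" and v: "v \<in> set C"
  shows "\<exists>\<sigma>. strict_shortcut V E C \<sigma> \<and> walk_length \<sigma> \<le> m \<and>
    within_steps (walk_edges C) m v (hd \<sigma>)"
proof -
  let ?near = "within_steps (walk_edges C)"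
  obtain c where c: "cyclic_labelling C c" "c 0 = v" using cycle_has_labelling[OF C(1) v] by auto
  define L where "L = int (walk_length C)"
  have L: "4 * int m \<le> L" using C(2) unfolding L_def by linarith
  have neq: "c i \<noteq> c j" if "i < j" "j < i + L" for i j
    using labelling_neq[OF c(1)] that unfolding L_def by blast
  have period: "c (i + L) = c i" for i
    using c(1) unfolding cyclic_labelling_def L_def by simp
  have inC: "c i \<in> set C" for i using c(1) unfolding cyclic_labelling_def by auto
  then have inV: "c i \<in> V" for i using C(1) by (auto simp: is_cycle_def)
  have CE: "walk_edges C \<subseteq> E" using C(1) by (simp add: is_cycle_def)
  have edge: "{c i, c (i + 1)} \<in> E" for i
    using CE labelling_edge_iff[OF c(1), of i "c (i + 1)"] by auto
  show ?thesis
  proof (cases "\<exists>i\<in>{0..<int m}. \<exists>y\<in>set C. {c i, y} \<in> E \<and> {c i, y} \<notin> walk_edges C")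
    case True
    then obtain i y where iy: "0 \<le> i" "i < int m" "y \<in> set C" "{c i, y} \<in> E"
      "{c i, y} \<notin> walk_edges C" by auto
    define f where "f k = (if k = 0 then c i else y)" for k :: nat
    have "c i \<noteq> y" using iy(4) G(1) by (auto simp: simple_graph_def)
    have "\<not> ?near 1 (c i) y"
    proof
      assume "?near 1 (c i) y"
      then obtain j where "\<bar>j - i\<bar> \<le> 1" "y = c j" unfolding labelling_within_steps[OF c(1)] by auto
      then have "j = i \<or> j = i + 1 \<or> j = i - 1" by arith
      then show False
        using \<open>y = c j\<close> \<open>c i \<noteq> y\<close> iy(5) labelling_edge_iff[OF c(1), of i y] by auto
    qed
    then have "strict_shortcut V E C (map f [0..<Suc 1])"
      using iy inV inC \<open>c i \<noteq> y\<close>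
      by (intro strict_shortcut_of_walk[OF G(1) C(1)]) (auto simp: f_def inj_on_def)
    moreover have "?near m (c 0) (c i)"
      unfolding labelling_within_steps[OF c(1)] using iy by (intro exI[of _ i]) auto
    ultimately show ?thesis
      using m c(2) by (intro exI[of _ "map f [0..<Suc 1]"]) (auto simp: walk_length_def f_def)
  next
    case False
    then have no_chord: "y = c (i + 1) \<or> y = c (i - 1)"
      if "0 \<le> i" "i < int m" "y \<in> set C" "{c i, y} \<in> E" for i y
      using that labelling_edge_iff[OF c(1), of i y] by auto
    define A where "A = c ` {0..<int m}"
    define F where "F = {x \<in> V - A. \<forall>z\<in>A. {z, x} \<notin> E}"
    define D where "D = {y. (c (int m + 1), y) \<in> {(x, y). {x, y} \<in> E \<and> x \<in> F \<and> y \<in> F}\<^sup>*}"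
    define S where "S = {s \<in> V - A. (\<exists>z\<in>A. {z, s} \<in> E) \<and> (\<exists>d\<in>D. {d, s} \<in> E)}"
    have A_conn: "(c 0, c i) \<in> {(x, y). {x, y} \<in> E \<and> x \<in> A \<and> y \<in> A}\<^sup>*" if "0 \<le> i" "i < int m" for i
      using that
    proof (induction i rule: int_ge_induct)
      case (step i)
      then have "(c i, c (i + 1)) \<in> {(x, y). {x, y} \<in> E \<and> x \<in> A \<and> y \<in> A}"
        using edge by (auto simp: A_def)
      then show ?case using step by (auto intro: rtrancl_into_rtrancl)
    qed simp
    have notA: "c j \<notin> A" if "int m \<le> j" "j < L" for j
    proof
      assume "c j \<in> A"
      then obtain i where "0 \<le> i" "i < int m" "c i = c j" unfolding A_def by auto
      then show False using neq[of i j] that by auto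
    qed
    \<comment> \<open>These indices run over the part of \<open>C\<close> strictly between \<open>c m\<close> and \<open>c (L - 1) = c (-1)\<close>.\<close>
    have cF: "c j \<in> F" if j: "int m + 1 \<le> j" "j \<le> L - 2" for j
    proof -
      have "{c i, c j} \<notin> E" if i: "0 \<le> i" "i < int m" for i
      proof
        assume "{c i, c j} \<in> E"
        then have "c j = c (i + 1) \<or> c j = c (i - 1)" using no_chord[OF i inC] by simp
        then show False using neq[of "i + 1" j] neq[of "i - 1" j] i j by auto
      qed
      then show ?thesis using notA[of j] j inV unfolding F_def A_def by auto
    qed
    have cD: "c j \<in> D" if j: "int m + 1 \<le> j" "j \<le> L - 2" for j
      using that
    proof (induction j rule: int_ge_induct)
      case base
      then show ?case by (simp add: D_def)
    next
      case (step j)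
      then have "(c j, c (j + 1)) \<in> {(x, y). {x, y} \<in> E \<and> x \<in> F \<and> y \<in> F}"
        using edge cF[of j] cF[of "j + 1"] by auto
      then show ?case using step unfolding D_def by (auto intro: rtrancl_into_rtrancl)
    qed
    have "minimal_ab_separator V E (c 0) (c (int m + 1)) S"
    proof (rule minimal_separator_of_connected_set[OF G _ _ _ F_def _ D_def S_def])
      show "A \<subseteq> V" "c 0 \<in> A" using inV m unfolding A_def by auto
      show "c (int m + 1) \<in> F" using cF L m by auto
      show "x \<in> A \<Longrightarrow> (c 0, x) \<in> {(x, y). {x, y} \<in> E \<and> x \<in> A \<and> y \<in> A}\<^sup>*" for x
        using A_conn unfolding A_def by auto
    qed
    then have diam: "vertex_set_diam V E S \<le> of_nat m"
      using sep inV unfolding minimal_vertex_separator_def by blast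
    have qS: "c (int m) \<in> S"
    proof -
      have "c (int m - 1) \<in> A" using m unfolding A_def by auto
      moreover have "c (int m + 1) \<in> D" using cD L m by auto
      moreover have "{c (int m - 1), c (int m)} \<in> E" "{c (int m + 1), c (int m)} \<in> E"
        using edge[of "int m - 1"] edge[of "int m"] by (auto simp: insert_commute)
      moreover have "c (int m) \<in> V - A" using notA[of "int m"] L m inV by auto
      ultimately show ?thesis unfolding S_def by blast
    qed
    have pS: "c (- 1) \<in> S"
    proof -
      have "c 0 \<in> A" using m unfolding A_def by auto
      moreover have "c (L - 2) \<in> D" using cD L m by auto
      moreover have last: "c (L - 1) = c (- 1)" using period[of "- 1"] by simp
      moreover have "{c 0, c (- 1)} \<in> E" "{c (L - 2), c (- 1)} \<in> E"
        using edge[of "- 1"] edge[of "L - 2"] last by (auto simp: insert_commute)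
      moreover have "c (- 1) \<in> V - A" using notA[of "L - 1"] last L m inV by auto
      ultimately show ?thesis unfolding S_def by blast
    qed
    have "ennreal (graph_dist V E (vertex_point (c (- 1))) (vertex_point (c (int m)))) \<le> of_nat m"
      using diam pS qS unfolding vertex_set_diam_def SUP_le_iff by blast
    then have "graph_dist V E (vertex_point (c (- 1))) (vertex_point (c (int m))) \<le> real m"
      by (simp add: ennreal_of_nat_eq_real_of_nat)
    then have short: "within_steps E m (c (- 1)) (c (int m))"
      using graph_dist_vertices_le_iff[OF G(1) inV connected_graph_rtrancl[OF G(2) inV inV]] by blast
    have far: "\<not> ?near m (c (- 1)) (c (int m))"
    proof
      assume "?near m (c (- 1)) (c (int m))"
      then obtain j where "\<bar>j - (- 1)\<bar> \<le> int m" "c (int m) = c j"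
        unfolding labelling_within_steps[OF c(1)] by auto
      moreover have "j < int m" "int m < j + L" using \<open>\<bar>j - (- 1)\<bar> \<le> int m\<close> L m by linarith+
      ultimately show False using neq[of j "int m"] by simp
    qed
    obtain \<sigma> where \<sigma>: "strict_shortcut V E C \<sigma>" "walk_length \<sigma> \<le> m" "?near (m - 1) (c (- 1)) (hd \<sigma>)"
      using first_strict_shortcut[OF G(1) C(1) inC inC short far] by auto
    have "?near 1 (c 0) (c (- 1))"
      unfolding labelling_within_steps[OF c(1)] by (intro exI[of _ "- 1"]) simp
    from within_steps_trans[OF this \<sigma>(3)] show ?thesis using \<sigma> m c(2) by auto
  qed
qed

theorem theorem2p17:
  fixes V :: "'v set" and E :: "'v set set" and m :: nat
  assumes "simple_graph V E"
    and "connected_graph V E"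
    and "uniform_graph V E"
    and "m \<ge> 1"
    and "\<And>S. minimal_vertex_separator V E S \<Longrightarrow> vertex_set_diam V E S \<le> of_nat m"
  shows "\<forall>\<epsilon>::real. \<epsilon> > 1 / 2 \<longrightarrow>
           densely_chordal V E (real m + \<epsilon>) (4 * real m) (2 * real m - 1)"
proof (intro allI impI)
  fix \<epsilon> :: real
  assume \<epsilon>: "1 / 2 < \<epsilon>"
  have "\<exists>\<sigma>s. (\<forall>\<sigma>\<in>set \<sigma>s. strict_shortcut V E C \<sigma> \<and> real (walk_length \<sigma>) \<le> 2 * real m - 1) \<and>
          eps_dense (walk_points C) (cycle_dist C) (real m + \<epsilon>)
            (\<Union>\<sigma>\<in>set \<sigma>s. {vertex_point (hd \<sigma>), vertex_point (last \<sigma>)})"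
    if C: "is_cycle V E C" "4 * real m \<le> real (walk_length C)" for C
  proof -
    have "4 * m \<le> walk_length C" using C(2) by linarith
    then have "\<forall>v\<in>set C. \<exists>\<sigma>. strict_shortcut V E C \<sigma> \<and> walk_length \<sigma> \<le> m \<and>
        within_steps (walk_edges C) m v (hd \<sigma>)"
      using shortcut_near_vertex[OF assms(1,2,4,5) C(1)] by blast
    then obtain s where s: "\<And>v. v \<in> set C \<Longrightarrow> strict_shortcut V E C (s v)"
      "\<And>v. v \<in> set C \<Longrightarrow> walk_length (s v) \<le> m"
      "\<And>v. v \<in> set C \<Longrightarrow> within_steps (walk_edges C) m v (hd (s v))"
      by metis
    note SC = simple_graph_cycle[OF assms(1) C(1)]
    let ?A = "\<Union>\<sigma>\<in>set (map s C). {vertex_point (hd \<sigma>), vertex_point (last \<sigma>)}"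
    have "?A \<subseteq> walk_points C"
      using s(1) unfolding strict_shortcut_def by auto
    moreover have "\<exists>a\<in>?A. cycle_dist C a x < real m + \<epsilon>" if x: "x \<in> walk_points C" for x
    proof -
      obtain v l where v: "v \<in> set C" "l \<le> 1/2" "joined (set C) (walk_edges C) (vertex_point v) x l"
        using near_vertex[OF SC x[unfolded walk_points_def]] by blast
      obtain j where j: "j \<le> m" "(v, hd (s v)) \<in> adj (walk_edges C) ^^ j"
        using s(3)[OF v(1)] unfolding within_steps_def by auto
      have "joined (set C) (walk_edges C) (vertex_point (hd (s v))) x (real j + l)"
        using joined_trans[OF v(3) joined_sym[OF joined_relpow[OF SC v(1) j(2)]]] .
      then have "cycle_dist C (vertex_point (hd (s v))) x \<le> real j + l"
        unfolding cycle_dist_def by (rule graph_dist_le)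
      then have "cycle_dist C (vertex_point (hd (s v))) x < real m + \<epsilon>"
        using j(1) v(2) \<epsilon> by linarith
      then show ?thesis using v(1) by auto
    qed
    ultimately have "eps_dense (walk_points C) (cycle_dist C) (real m + \<epsilon>) ?A"
      unfolding eps_dense_def by blast
    moreover have "real (walk_length (s v)) \<le> 2 * real m - 1" if "v \<in> set C" for v
      using s(2)[OF that] assms(4) by linarith
    ultimately show ?thesis using s(1) by (intro exI[of _ "map s C"]) auto
  qed
  then show "densely_chordal V E (real m + \<epsilon>) (4 * real m) (2 * real m - 1)"
    using assms(4) unfolding densely_chordal_def by auto
qed

end
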